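(* Let $\mathbb{X}, \mathbb{Y}$ be real Banach spaces, let $T \in \mathbb{L}(\mathbb{X},\mathbb{Y})$ and let $x \in M_T$. Then: (i) $T(x^{+} \setminus x^{\perp}) \subseteq (Tx)^{+} \setminus (Tx)^{\perp}$; (ii) $T(x^{-} \setminus x^{\perp}) \subseteq (Tx)^{-} \setminus (Tx)^{\perp}$. If in addition both $\mathbb{X}$ and $\mathbb{Y}$ are smooth, then $T(x^{\perp}) \subseteq (Tx)^{\perp}$.
   Context: $\mathbb{L}(\mathbb{X},\mathbb{Y})$ is the space of bounded linear operators from $\mathbb{X}$ to $\mathbb{Y}$. $S_{\mathbb{X}} = \{x \in \mathbb{X} : \|x\| = 1\}$. For $T \in \mathbb{L}(\mathbb{X},\mathbb{Y})$, $M_T = \{x \in S_{\mathbb{X}} : \|Tx\| = \|T\|\}$. For elements $x,y$ of a real Banach space: $x \perp_B y$ (Birkhoff-James orthogonality) means $\|x\| \le \|x + \lambda y\|$ for all $\lambda \in \mathbb{R}$; $x^{\perp} = \{y : x \perp_B y\}$; $y \in x^{+}$ means $\|x + \lambda y\| \ge \|x\|$ for all $\lambda \ge 0$; $y \in x^{-}$ means $\|x + \lambda y\| \ge \|x\|$ for all $\lambda \le 0$. The sets $(Tx)^{+}, (Tx)^{-}, (Tx)^{\perp}$ are formed in $\mathbb{Y}$. A Banach space is smooth if at each point $x$ of its unit sphere there is a unique supporting hyperplane to the unit ball, i.e. a unique norm-one functional $f$ with $f(x) = 1$.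
   Formalization: Inclusions (i) and (ii) are stated only for T ≠ 0, since for T = 0 they fail (x lies in x^+ \ x^⊥, and -x in x^- \ x^⊥, while the right-hand sides are empty); the smooth case is stated for all T. *)

theory Defs
  imports "HOL-Analysis.Analysis"
begin

definition bj_orthogonal :: "'a::real_normed_vector \<Rightarrow> 'a \<Rightarrow> bool"  (infix "\<perp>\<^sub>B" 50)
  where "x \<perp>\<^sub>B y \<longleftrightarrow> (\<forall>l::real. norm x \<le> norm (x + l *\<^sub>R y))"

definition bj_perp :: "'a::real_normed_vector \<Rightarrow> 'a set"
  where "bj_perp x = {y. x \<perp>\<^sub>B y}"

definition bj_plus :: "'a::real_normed_vector \<Rightarrow> 'a set"
  where "bj_plus x = {y. \<forall>l::real. l \<ge> 0 \<longrightarrow> norm (x + l *\<^sub>R y) \<ge> norm x}"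

definition bj_minus :: "'a::real_normed_vector \<Rightarrow> 'a set"
  where "bj_minus x = {y. \<forall>l::real. l \<le> 0 \<longrightarrow> norm (x + l *\<^sub>R y) \<ge> norm x}"

definition norm_attaining_set :: "('a::real_normed_vector \<Rightarrow>\<^sub>L 'b::real_normed_vector) \<Rightarrow> 'a set"
  where "norm_attaining_set T = {x \<in> sphere 0 1. norm (blinfun_apply T x) = norm T}"

text \<open>A supporting hyperplane to the unit ball at a unit vector \<open>x\<close> is identified with the
  norm-one functional \<open>f\<close> with \<open>f x = 1\<close>; smoothness is a property of the whole space,
  hence the type argument.\<close>

definition smooth_space :: "'a::real_normed_vector itself \<Rightarrow> bool"
  where "smooth_space _ \<longleftrightarrow>
    (\<forall>x::'a. norm x = 1 \<longrightarrow> (\<exists>!f::'a \<Rightarrow>\<^sub>L real. norm f = 1 \<and> blinfun_apply f x = 1))"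

end

theory Submission
  imports Defs
begin

text \<open>
  The first two inclusions come from convexity. If \<open>y\<close> lies in \<open>x\<^sup>+\<close> but is not orthogonal to
  \<open>x\<close>, then some \<open>l < 0\<close> satisfies \<open>\<parallel>x + l y\<parallel> < \<parallel>x\<parallel>\<close>. Since \<open>T \<noteq> 0\<close> attains its norm at \<open>x\<close>, this strict
  decrease survives: \<open>\<parallel>Tx + l Ty\<parallel> \<le> \<parallel>T\<parallel> \<parallel>x + l y\<parallel> < \<parallel>Tx\<parallel>\<close>. So \<open>Ty\<close> is not orthogonal to \<open>Tx\<close>, and
  a convex function that drops below its value at \<open>0\<close> on the left of \<open>0\<close> cannot do so on the
  right, so \<open>Ty\<close> lies in \<open>(Tx)\<^sup>+\<close>. The second inclusion is the first one for \<open>-y\<close>.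

  The third inclusion goes through supporting functionals; let \<open>T \<noteq> 0\<close>. If \<open>g\<close> supports the unit ball of the
  codomain at \<open>Tx / \<parallel>T\<parallel>\<close>, then \<open>g \<circ> T / \<parallel>T\<parallel>\<close> supports the unit ball of the domain at \<open>x\<close>, hence is
  the unique supporting functional \<open>f\<close> there. James' characterisation (\<open>smooth_orthogonal_imp_zero\<close>
  below) says that \<open>f\<close> vanishes on every \<open>y\<close> orthogonal to \<open>x\<close>, so \<open>g (Ty) = 0\<close>, and then
  \<open>\<parallel>Tx\<parallel> = g (Tx + l Ty) \<le> \<parallel>Tx + l Ty\<parallel>\<close> for all \<open>l\<close>.

  James' characterisation is usually derived from the Hahn--Banach theorem. Smoothness, however,
  supplies a supporting functional at every unit vector, so compactness is enough: supporting
  functionals at \<open>x + t y\<close> with \<open>t > 0\<close> are nonnegative at \<open>y\<close>, and by the Banach--Alaoglu theorem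
  they accumulate, as \<open>t \<rightarrow> 0\<close>, at a supporting functional at \<open>x\<close> that is still nonnegative at \<open>y\<close>.
  The same applies to \<open>-y\<close>, and by uniqueness the two limits agree, so their value at \<open>y\<close> is \<open>0\<close>.
\<close>

section \<open>One-sided orthogonality and norm attainment\<close>

lemma norm_attaining_setD:
  assumes "x \<in> norm_attaining_set T"
  shows "norm x = 1" and "norm (blinfun_apply T x) = norm T"
  using assms by (auto simp: norm_attaining_set_def)

lemma bj_minus_iff_uminus: "y \<in> bj_minus x \<longleftrightarrow> - y \<in> bj_plus x"
proof
  assume y: "y \<in> bj_minus x"
  have "norm x \<le> norm (x + l *\<^sub>R (- y))" if "l \<ge> 0" for l
  proof -
    have "norm x \<le> norm (x + (- l) *\<^sub>R y)"
      using y that unfolding bj_minus_def by (simp del: scaleR_minus_left)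
    then show ?thesis by simp
  qed
  then show "- y \<in> bj_plus x" by (simp only: bj_plus_def mem_Collect_eq) blast
next
  assume y: "- y \<in> bj_plus x"
  have "norm x \<le> norm (x + l *\<^sub>R y)" if "l \<le> 0" for l
  proof -
    have "norm x \<le> norm (x + (- l) *\<^sub>R (- y))"
      using y that unfolding bj_plus_def by (simp del: scaleR_minus_left scaleR_minus_right)
    then show ?thesis by simp
  qed
  then show "y \<in> bj_minus x" by (simp add: bj_minus_def)
qed

lemma bj_perp_eq_plus_Int_minus: "bj_perp x = bj_plus x \<inter> bj_minus x"
  unfolding bj_perp_def bj_orthogonal_def bj_plus_def bj_minus_def
  using linear[of 0] by blast

lemma bj_perp_uminus_iff: "- y \<in> bj_perp x \<longleftrightarrow> y \<in> bj_perp x"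
  by (auto simp: bj_perp_eq_plus_Int_minus bj_minus_iff_uminus)

text \<open>The point \<open>x\<close> lies on the segment from \<open>x + l y\<close> to \<open>x + m y\<close>; if the norm were smaller than
  \<open>\<parallel>x\<parallel>\<close> at both ends, it would be smaller than \<open>\<parallel>x\<parallel>\<close> at \<open>x\<close> itself.\<close>

lemma norm_decrease_imp_bj_plus:
  fixes x y :: "'a::real_normed_vector"
  assumes "l < 0" and "norm (x + l *\<^sub>R y) < norm x"
  shows "y \<in> bj_plus x"
  unfolding bj_plus_def
proof (intro CollectI allI impI)
  fix m :: real
  assume "m \<ge> 0"
  have "(m - l) *\<^sub>R x = m *\<^sub>R (x + l *\<^sub>R y) + (- l) *\<^sub>R (x + m *\<^sub>R y)"
    by (simp add: algebra_simps)
  then have "norm ((m - l) *\<^sub>R x) \<le> norm (m *\<^sub>R (x + l *\<^sub>R y)) + norm ((- l) *\<^sub>R (x + m *\<^sub>R y))"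
    by (metis norm_triangle_ineq)
  then have "(m - l) * norm x \<le> m * norm (x + l *\<^sub>R y) + (- l) * norm (x + m *\<^sub>R y)"
    using \<open>l < 0\<close> \<open>m \<ge> 0\<close> by simp
  also have "\<dots> \<le> m * norm x + (- l) * norm (x + m *\<^sub>R y)"
    using assms(2) \<open>m \<ge> 0\<close> by (simp add: mult_left_mono)
  finally have "(- l) * norm x \<le> (- l) * norm (x + m *\<^sub>R y)"
    by (simp add: algebra_simps)
  then show "norm x \<le> norm (x + m *\<^sub>R y)"
    using \<open>l < 0\<close> by (simp add: mult_le_cancel_left)
qed

lemma norm_attaining_preserves_strict_plus:
  fixes T :: "'a::real_normed_vector \<Rightarrow>\<^sub>L 'b::real_normed_vector"
  assumes "x \<in> norm_attaining_set T" and "T \<noteq> 0" and "y \<in> bj_plus x - bj_perp x"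
  shows "blinfun_apply T y \<in> bj_plus (blinfun_apply T x) - bj_perp (blinfun_apply T x)"
proof -
  note nx = norm_attaining_setD[OF assms(1)]
  have "y \<notin> bj_minus x"
    using assms(3) by (auto simp: bj_perp_eq_plus_Int_minus)
  then obtain l where l: "l \<le> 0" "norm (x + l *\<^sub>R y) < 1"
    using nx(1) by (auto simp: bj_minus_def not_le)
  then have "l < 0"
    using nx(1) by (cases "l = 0") auto
  have "norm (blinfun_apply T x + l *\<^sub>R blinfun_apply T y) = norm (blinfun_apply T (x + l *\<^sub>R y))"
    by (simp add: blinfun.bilinear_simps)
  also have "\<dots> \<le> norm T * norm (x + l *\<^sub>R y)"
    by (rule norm_blinfun)
  also have "\<dots> < norm T"
    using l(2) \<open>T \<noteq> 0\<close> by (simp add: mult_less_cancel_left2)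
  finally have less: "norm (blinfun_apply T x + l *\<^sub>R blinfun_apply T y) < norm (blinfun_apply T x)"
    by (simp add: nx(2))
  then have "\<not> (blinfun_apply T x) \<perp>\<^sub>B (blinfun_apply T y)"
    unfolding bj_orthogonal_def by (meson not_le)
  then show ?thesis
    using norm_decrease_imp_bj_plus[OF \<open>l < 0\<close> less] by (simp add: bj_perp_def)
qed

lemma norm_attaining_preserves_strict_minus:
  fixes T :: "'a::real_normed_vector \<Rightarrow>\<^sub>L 'b::real_normed_vector"
  assumes "x \<in> norm_attaining_set T" and "T \<noteq> 0" and "y \<in> bj_minus x - bj_perp x"
  shows "blinfun_apply T y \<in> bj_minus (blinfun_apply T x) - bj_perp (blinfun_apply T x)"
  using norm_attaining_preserves_strict_plus[OF assms(1,2), of "- y"] assms(3)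
  by (simp add: bj_minus_iff_uminus bj_perp_uminus_iff blinfun.minus_right)

section \<open>Weak-star compactness of the dual unit ball\<close>

text \<open>Linearity and the bound \<open>\<bar>\<phi> z\<bar> \<le> \<parallel>z\<parallel>\<close> each constrain finitely many values of \<open>\<phi>\<close> at a time, so
  they cut a closed set out of the product of the intervals \<open>[-\<parallel>z\<parallel>, \<parallel>z\<parallel>]\<close>, which is compact by
  Tychonoff's theorem. The topology on functions is that of pointwise convergence, that is,
  weak-star convergence of functionals.\<close>

theorem Banach_Alaoglu:
  "compact (blinfun_apply ` cball (0 :: 'a::real_normed_vector \<Rightarrow>\<^sub>L real) 1)"
proof -
  let ?P = "PiE UNIV (\<lambda>z::'a. {- norm z .. norm z})"
  let ?L = "(\<Inter>u. \<Inter>v. {\<phi> :: 'a \<Rightarrow> real. \<phi> (u + v) = \<phi> u + \<phi> v}) \<inter>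
            (\<Inter>c. \<Inter>u. {\<phi> :: 'a \<Rightarrow> real. \<phi> (c *\<^sub>R u) = c * \<phi> u})"
  have "compact ?P"
    using compactin_PiE[of "\<lambda>_. euclidean" UNIV "\<lambda>z::'a. {- norm z .. norm z}"]
    by (simp add: euclidean_product_topology)
  moreover have "closed ?L"
    by (intro closed_Int closed_INT ballI closed_Collect_eq continuous_intros
        continuous_on_product_coordinates)
  moreover have "blinfun_apply ` cball (0 :: 'a \<Rightarrow>\<^sub>L real) 1 = ?P \<inter> ?L"
  proof (intro equalityI subsetI)
    fix \<phi> :: "'a \<Rightarrow> real"
    assume "\<phi> \<in> blinfun_apply ` cball 0 1"
    then obtain f :: "'a \<Rightarrow>\<^sub>L real" where f: "norm f \<le> 1" "\<phi> = blinfun_apply f"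
      by auto
    have "\<bar>blinfun_apply f z\<bar> \<le> norm z" for z
      using norm_blinfun[of f z] mult_right_mono[OF f(1), of "norm z"] by simp
    then show "\<phi> \<in> ?P \<inter> ?L"
      unfolding f(2) by (auto simp: blinfun.bilinear_simps abs_le_iff minus_le_iff)
  next
    fix \<phi> :: "'a \<Rightarrow> real"
    assume \<phi>: "\<phi> \<in> ?P \<inter> ?L"
    then have bd: "norm (\<phi> z) \<le> norm z * 1" for z
      by (auto simp: PiE_def Pi_def abs_le_iff minus_le_iff)
    have "bounded_linear \<phi>"
      using \<phi> by (intro bounded_linear_intro[OF _ _ bd]) auto
    then have eq: "blinfun_apply (Blinfun \<phi>) = \<phi>"
      by (rule bounded_linear_Blinfun_apply)
    have "norm (Blinfun \<phi>) \<le> 1"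
      by (rule norm_blinfun_bound) (use bd in \<open>auto simp: eq\<close>)
    then show "\<phi> \<in> blinfun_apply ` cball 0 1"
      using eq by (metis image_eqI mem_cball_0)
  qed
  ultimately show ?thesis
    by (simp add: compact_Int_closed)
qed

section \<open>Supporting functionals and orthogonality\<close>

lemma smooth_space_norming_functional:
  fixes z :: "'a::real_normed_vector"
  assumes "smooth_space TYPE('a)" and "z \<noteq> 0"
  obtains f :: "'a \<Rightarrow>\<^sub>L real" where "norm f = 1" and "blinfun_apply f z = norm z"
proof -
  have "norm (z /\<^sub>R norm z) = 1"
    using \<open>z \<noteq> 0\<close> by simp
  then obtain f :: "'a \<Rightarrow>\<^sub>L real" where "norm f = 1" "blinfun_apply f (z /\<^sub>R norm z) = 1"
    using assms(1) unfolding smooth_space_def by blast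
  then show ?thesis
    using that \<open>z \<noteq> 0\<close> by (simp add: blinfun.scaleR_right field_simps)
qed

lemma blinfun_le_norm_of_norm_le_1:
  fixes f :: "'a::real_normed_vector \<Rightarrow>\<^sub>L real"
  assumes "norm f \<le> 1"
  shows "blinfun_apply f z \<le> norm z"
  using norm_blinfun[of f z] mult_right_mono[OF assms, of "norm z"] by simp

text \<open>A norming functional at \<open>x + t y\<close> with \<open>t > 0\<close> takes a value \<open>\<parallel>x + t y\<parallel> \<ge> \<parallel>x\<parallel>\<close> there but at
  most \<open>\<parallel>x\<parallel>\<close> at \<open>x\<close>, so it is nonnegative at \<open>y\<close>; also its value at \<open>x\<close> is at least \<open>\<parallel>x\<parallel> - t \<parallel>y\<parallel>\<close>. For
  \<open>t \<rightarrow> 0\<close> these conditions define a decreasing sequence of weak-star closed sets that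
  meet the dual unit ball, so by compactness they have a common point in it.\<close>

lemma bj_plus_supporting_functional_nonneg:
  fixes x y :: "'a::real_normed_vector"
  assumes sm: "smooth_space TYPE('a)" and nx: "norm x = 1" and y: "y \<in> bj_plus x"
  obtains f :: "'a \<Rightarrow>\<^sub>L real"
  where "norm f = 1" and "blinfun_apply f x = 1" and "blinfun_apply f y \<ge> 0"
proof -
  let ?K = "blinfun_apply ` cball (0 :: 'a \<Rightarrow>\<^sub>L real) 1"
  define B where "B n = {\<phi>. 0 \<le> \<phi> y \<and> 1 - inverse (real (Suc n)) * norm y \<le> \<phi> x}"
    for n
  have closed_B: "closed (B n)" for n
    unfolding B_def
    by (intro closed_Collect_conj closed_Collect_le continuous_intros
        continuous_on_product_coordinates)
  have nonempty: "?K \<inter> B n \<noteq> {}" for n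
  proof -
    define t where "t = inverse (real (Suc n))"
    have t: "t > 0" by (simp add: t_def)
    have ge: "norm (x + t *\<^sub>R y) \<ge> 1"
      using y t nx by (auto simp: bj_plus_def)
    then have "x + t *\<^sub>R y \<noteq> 0" by auto
    then obtain f :: "'a \<Rightarrow>\<^sub>L real" where f: "norm f = 1"
      "blinfun_apply f (x + t *\<^sub>R y) = norm (x + t *\<^sub>R y)"
      using smooth_space_norming_functional[OF sm] by blast
    have sum: "blinfun_apply f x + t * blinfun_apply f y \<ge> 1"
      using f(2) ge by (simp add: blinfun.bilinear_simps)
    have le: "blinfun_apply f x \<le> 1" "blinfun_apply f y \<le> norm y"
      using blinfun_le_norm_of_norm_le_1[of f] f(1) nx by (metis order_refl)+
    have "t * blinfun_apply f y \<ge> 0"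
      using sum le(1) by linarith
    then have "blinfun_apply f y \<ge> 0"
      using t by (simp add: zero_le_mult_iff)
    moreover have "1 - t * norm y \<le> blinfun_apply f x"
      using sum mult_left_mono[OF le(2), of t] t by linarith
    ultimately have "blinfun_apply f \<in> ?K \<inter> B n"
      using f(1) by (simp add: B_def t_def)
    then show ?thesis by blast
  qed
  have decseq: "B n \<subseteq> B m" if "m \<le> n" for m n
  proof -
    have "inverse (real (Suc n)) * norm y \<le> inverse (real (Suc m)) * norm y"
      using that by (intro mult_right_mono le_imp_inverse_le) auto
    then show ?thesis unfolding B_def by auto
  qed
  have "?K \<inter> (\<Inter>n\<in>UNIV. B n) \<noteq> {}"
  proof (rule compact_imp_fip_image[OF Banach_Alaoglu closed_B])
    fix I :: "nat set"
    assume "finite I"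
    then obtain N where "\<forall>n\<in>I. n \<le> N"
      using finite_nat_set_iff_bounded_le by blast
    then have "B N \<subseteq> (\<Inter>n\<in>I. B n)"
      using decseq by blast
    then show "?K \<inter> (\<Inter>n\<in>I. B n) \<noteq> {}"
      using nonempty[of N] by blast
  qed
  then obtain f :: "'a \<Rightarrow>\<^sub>L real" where f: "norm f \<le> 1" and "\<forall>n. blinfun_apply f \<in> B n"
    by auto
  then have fB: "blinfun_apply f \<in> B n" for n
    by blast
  have "blinfun_apply f y \<ge> 0"
    using fB[of 0] by (simp add: B_def)
  moreover have fx: "blinfun_apply f x = 1"
  proof (rule antisym)
    show "blinfun_apply f x \<le> 1"
      using blinfun_le_norm_of_norm_le_1[OF f, of x] nx by simp
    have "(\<lambda>n. 1 - inverse (real (Suc n)) * norm y) \<longlonglongrightarrow> 1 - 0 * norm y"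
      by (intro tendsto_intros LIMSEQ_inverse_real_of_nat)
    moreover have "1 - inverse (real (Suc n)) * norm y \<le> blinfun_apply f x" for n
      using fB[of n] by (simp add: B_def)
    ultimately show "1 \<le> blinfun_apply f x"
      by (intro LIMSEQ_le_const2[of _ 1]) auto
  qed
  moreover have "norm f = 1"
    using norm_blinfun[of f x] fx nx f by simp
  ultimately show ?thesis using that by blast
qed

text \<open>One half of James' characterisation of orthogonality in smooth spaces: a nonnegative and a
  nonpositive supporting functional coincide by uniqueness.\<close>

lemma smooth_orthogonal_imp_zero:
  fixes x y :: "'a::real_normed_vector" and f :: "'a \<Rightarrow>\<^sub>L real"
  assumes sm: "smooth_space TYPE('a)" and nx: "norm x = 1" and y: "y \<in> bj_perp x"
    and f: "norm f = 1" "blinfun_apply f x = 1"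
  shows "blinfun_apply f y = 0"
proof -
  have uniq: "g = f" if "norm g = 1" "blinfun_apply g x = 1" for g :: "'a \<Rightarrow>\<^sub>L real"
    using sm nx f that unfolding smooth_space_def by blast
  have "y \<in> bj_plus x" "- y \<in> bj_plus x"
    using y by (auto simp: bj_perp_eq_plus_Int_minus bj_minus_iff_uminus)
  then have "blinfun_apply f y \<ge> 0" "blinfun_apply f (- y) \<ge> 0"
    using bj_plus_supporting_functional_nonneg[OF sm nx] uniq by metis+
  then show ?thesis
    by (simp add: blinfun.minus_right)
qed

text \<open>The converse half of James' characterisation: \<open>f\<close> is constant along the line \<open>x + l y\<close> and
  bounded by the norm there.\<close>

lemma norming_functional_zero_imp_bj_perp:
  fixes f :: "'a::real_normed_vector \<Rightarrow>\<^sub>L real"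
  assumes "norm f \<le> 1" and "blinfun_apply f x = norm x" and "blinfun_apply f y = 0"
  shows "y \<in> bj_perp x"
proof -
  have "norm x \<le> norm (x + l *\<^sub>R y)" for l
    using blinfun_le_norm_of_norm_le_1[OF assms(1), of "x + l *\<^sub>R y"] assms(2,3)
    by (simp add: blinfun.bilinear_simps)
  then show ?thesis
    by (simp add: bj_perp_def bj_orthogonal_def)
qed

lemma norm_attaining_preserves_perp:
  fixes T :: "'a::real_normed_vector \<Rightarrow>\<^sub>L 'b::real_normed_vector"
  assumes "x \<in> norm_attaining_set T" and sma: "smooth_space TYPE('a)" and smb: "smooth_space TYPE('b)"
    and y: "y \<in> bj_perp x"
  shows "blinfun_apply T y \<in> bj_perp (blinfun_apply T x)"
proof (cases "T = 0")
  case True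
  then show ?thesis by (simp add: bj_perp_def bj_orthogonal_def)
next
  case False
  note nx = norm_attaining_setD[OF assms(1)]
  have "blinfun_apply T x \<noteq> 0"
    using nx(2) False by auto
  then obtain g :: "'b \<Rightarrow>\<^sub>L real" where g: "norm g = 1"
    "blinfun_apply g (blinfun_apply T x) = norm (blinfun_apply T x)"
    using smooth_space_norming_functional[OF smb] by blast
  define f where "f = (g o\<^sub>L T) /\<^sub>R norm T"
  have f_apply: "blinfun_apply f z = blinfun_apply g (blinfun_apply T z) / norm T" for z
    by (simp add: f_def blinfun.scaleR_left field_simps)
  have fx: "blinfun_apply f x = 1"
    using g(2) nx(2) False by (simp add: f_apply)
  have "norm (g o\<^sub>L T) \<le> norm T"
    using norm_blinfun_compose[of g T] g(1) by simp
  then have "norm f \<le> 1"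
    using False by (simp add: f_def field_simps)
  moreover have "1 \<le> norm f"
    using norm_blinfun[of f x] fx nx(1) by simp
  ultimately have "norm f = 1" by simp
  then have "blinfun_apply f y = 0"
    using smooth_orthogonal_imp_zero[OF sma nx(1) y _ fx] by simp
  then have "blinfun_apply g (blinfun_apply T y) = 0"
    using False by (simp add: f_apply)
  then show ?thesis
    using norming_functional_zero_imp_bj_perp[of g] g by simp
qed

section \<open>Images of the orthogonality sets under a norm-attaining operator\<close>

theorem theorem2p2:
  fixes T :: "'a::banach \<Rightarrow>\<^sub>L 'b::banach" and x :: 'a
  assumes "x \<in> norm_attaining_set T"
  shows "(T \<noteq> 0 \<longrightarrow>
            blinfun_apply T ` (bj_plus x - bj_perp x)
              \<subseteq> bj_plus (blinfun_apply T x) - bj_perp (blinfun_apply T x))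
       \<and> (T \<noteq> 0 \<longrightarrow>
            blinfun_apply T ` (bj_minus x - bj_perp x)
              \<subseteq> bj_minus (blinfun_apply T x) - bj_perp (blinfun_apply T x))
       \<and> (smooth_space TYPE('a) \<and> smooth_space TYPE('b) \<longrightarrow>
            blinfun_apply T ` bj_perp x \<subseteq> bj_perp (blinfun_apply T x))"
  using norm_attaining_preserves_strict_plus[OF assms]
    norm_attaining_preserves_strict_minus[OF assms]
    norm_attaining_preserves_perp[OF assms]
  by (intro conjI impI image_subsetI) simp_all

end
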